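(* Let $b \ge 2$ and $s \ge 1$ be integers and let $\boldsymbol{e}=(e_1,\ldots,e_s) \in \mathbb{N}^s$ with $e_1 \le e_2 \le \cdots \le e_s$. Let $t$ and $m$ be integers with $2 \le t \le s$ and $m \ge e_{s-t+1} + \cdots + e_{s-1}+e_s$. If there exists a $(0,m,\boldsymbol{e},s)$-net in base $b$, then there exists a mixed orthogonal array $\mathrm{OA}\left(b^m,l_1^1 \cdots l_s^1,t\right)$ with $l_i=b^{e_i}$ for $1 \le i \le s$.
   Context: $\mathbb{N}$ denotes the set of positive integers, $\lambda_s$ the $s$-dimensional Lebesgue measure, and $R(l)=\{0,1,\ldots,l-1\}\subset\mathbb{Z}$ for every integer $l\ge 2$. Elementary interval: for integers $b\ge 2$, $s\ge 1$, an interval $J\subseteq[0,1)^s$ is an elementary interval in base $b$ if $J=\prod_{i=1}^s [a_ib^{-d_i},(a_i+1)b^{-d_i})$ with integers $d_i\ge 0$ and $0\le a_i<b^{d_i}$ for $1\le i\le s$. $(u,m,\boldsymbol{e},s)$-net: let $b\ge 2$, $s\ge 1$, $0\le u\le m$ be integers and $\boldsymbol{e}=(e_1,\ldots,e_s)\in\mathbb{N}^s$. A point set $\mathcal{P}$ of $b^m$ points in $[0,1)^s$ (an indexed family; points are counted with multiplicity) is a $(u,m,\boldsymbol{e},s)$-net in base $b$ if every elementary interval $J=\prod_{i=1}^s [a_ib^{-d_i},(a_i+1)b^{-d_i})$ in base $b$, with integers $d_i\ge 0$, $0\le a_i<b^{d_i}$ and $e_i\mid d_i$ for $1\le i\le s$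 and with volume $\lambda_s(J)\ge b^{u-m}$, contains exactly $b^m\lambda_s(J)$ points of $\mathcal{P}$. Mixed orthogonal array: let $N\ge 1$, $l_1,\ldots,l_v\ge 2$ (not necessarily distinct), $k_1,\ldots,k_v\ge 1$, and $0\le t\le k:=k_1+\cdots+k_v$ be integers. A mixed orthogonal array $\mathrm{OA}(N,l_1^{k_1}\cdots l_v^{k_v},t)$ is an array of size $N\times k$ in which the first $k_1$ columns have symbols from $R(l_1)$, the next $k_2$ columns have symbols from $R(l_2)$, and so on, with the property that in any $N\times t$ subarray (formed by $t$ of the columns) every possible $t$-tuple (of symbols from the respective alphabets of these columns) occurs an equal number of times as a row. *)

theory Defs
  imports "HOL-Analysis.Analysis"
begin

text \<open>
  Points of \<open>\<real>\<^sup>s\<close> are functions on the index set \<open>{1..s}\<close>, extensional outside of it;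
  this is the carrier of the product measure below.
\<close>

definition lebesgue_measure :: "nat \<Rightarrow> (nat \<Rightarrow> real) measure" where
  "lebesgue_measure s = (\<Pi>\<^sub>M i\<in>{1..s}. lborel)"

definition unit_cube :: "nat \<Rightarrow> (nat \<Rightarrow> real) set" where
  "unit_cube s = (\<Pi>\<^sub>E i\<in>{1..s}. {0..<1})"

definition elementary_box :: "nat \<Rightarrow> nat \<Rightarrow> (nat \<Rightarrow> nat) \<Rightarrow> (nat \<Rightarrow> nat) \<Rightarrow> (nat \<Rightarrow> real) set" where
  "elementary_box b s d a =
     (\<Pi>\<^sub>E i\<in>{1..s}. {real (a i) / real b ^ d i ..< (real (a i) + 1) / real b ^ d i})"

text \<open>
  A point set is an indexed family \<open>P 0, \<dots>, P (b ^ m - 1)\<close>, so that points are counted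
  with multiplicity.
\<close>

definition is_net ::
    "nat \<Rightarrow> nat \<Rightarrow> nat \<Rightarrow> (nat \<Rightarrow> nat) \<Rightarrow> nat \<Rightarrow> (nat \<Rightarrow> nat \<Rightarrow> real) \<Rightarrow> bool" where
  "is_net b u m e s P \<longleftrightarrow>
     b \<ge> 2 \<and> s \<ge> 1 \<and> u \<le> m \<and> (\<forall>i\<in>{1..s}. e i \<ge> 1) \<and>
     (\<forall>n<b ^ m. P n \<in> unit_cube s) \<and>
     (\<forall>d a. (\<forall>i\<in>{1..s}. a i < b ^ d i \<and> e i dvd d i) \<longrightarrow>
        measure (lebesgue_measure s) (elementary_box b s d a) \<ge> real b powi (int u - int m) \<longrightarrow>
        real (card {n. n < b ^ m \<and> P n \<in> elementary_box b s d a}) =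
          real b ^ m * measure (lebesgue_measure s) (elementary_box b s d a))"

definition R :: "nat \<Rightarrow> nat set" where
  "R l = {0..<l}"

text \<open>
  The type \<open>l\<^sub>1\<^bsup>k\<^sub>1\<^esup> \<dots> l\<^sub>v\<^bsup>k\<^sub>v\<^esup>\<close> of a mixed orthogonal array is the list
  \<open>[(l\<^sub>1, k\<^sub>1), \<dots>, (l\<^sub>v, k\<^sub>v)]\<close>; \<open>column_levels\<close> lists the alphabet size of each column.
\<close>

definition column_levels :: "(nat \<times> nat) list \<Rightarrow> nat list" where
  "column_levels lks = concat (map (\<lambda>(l, k). replicate k l) lks)"

text \<open>
  \<open>A r j\<close> is the entry in row \<open>r\<close> and column \<open>j\<close>, both counted from \<open>0\<close>; entries outside
  of the \<open>N \<times> k\<close> range are irrelevant.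
\<close>

definition is_mixed_OA ::
    "nat \<Rightarrow> (nat \<times> nat) list \<Rightarrow> nat \<Rightarrow> (nat \<Rightarrow> nat \<Rightarrow> nat) \<Rightarrow> bool" where
  "is_mixed_OA N lks t A \<longleftrightarrow>
     (let ls = column_levels lks; k = length ls in
        N \<ge> 1 \<and> lks \<noteq> [] \<and> (\<forall>(l, k)\<in>set lks. l \<ge> 2 \<and> k \<ge> 1) \<and> t \<le> k \<and>
        (\<forall>r<N. \<forall>j<k. A r j \<in> R (ls ! j)) \<and>
        (\<forall>C. C \<subseteq> {..<k} \<longrightarrow> card C = t \<longrightarrow>
           (\<exists>c. \<forall>x\<in>(\<Pi>\<^sub>E j\<in>C. R (ls ! j)).
              card {r. r < N \<and> (\<forall>j\<in>C. A r j = x j)} = c)))"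

end

theory Submission
  imports Defs
begin

text \<open>
  Cut the \<open>i\<close>-th axis of the unit cube into \<open>b ^ e i\<close> half-open cells of equal length and let
  row \<open>r\<close> of the array record, coordinate by coordinate, the index of the cell that contains
  the \<open>r\<close>-th point of the net. Prescribing the entries of a row in a set \<open>D\<close> of \<open>t\<close> columns
  then means that the point lies in the elementary box with resolution \<open>d i = e i\<close> on \<open>D\<close> and
  \<open>d i = 0\<close> elsewhere (\<open>cell_index_eq_iff\<close>). All these resolutions are multiples of \<open>e i\<close>, and
  the box has volume \<open>b\<close> to the power \<open>- (\<Sum>i\<in>D. e i)\<close> whatever the prescribed symbols are
  (\<open>measure_elementary_box\<close>).

  The net property with \<open>u = 0\<close> applies to boxes of volume at least \<open>b\<close> to the power \<open>- m\<close>, that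
  is, when \<open>(\<Sum>i\<in>D. e i) \<le> m\<close>. Since \<open>e\<close> is increasing, the sum over any \<open>t\<close> indices is at most
  the sum over the last \<open>t\<close> indices (\<open>sum_le_sum_upper_set\<close>), which is at most \<open>m\<close> by
  assumption. So each symbol tuple occurs exactly \<open>b ^ (m - (\<Sum>i\<in>D. e i))\<close> times, a number that
  does not depend on the tuple.
\<close>

text \<open>
  Only the two differences matter. They have the same size, and any bijection from \<open>D - T\<close> to
  \<open>T - D\<close> moves every index upwards.
\<close>

lemma sum_le_sum_upper_set:
  fixes e :: "'a::linorder \<Rightarrow> nat"
  assumes "finite A" "mono_on A e" "D \<subseteq> A" "T \<subseteq> A" "card D = card T"
    and upper: "\<And>x y. x \<in> A - T \<Longrightarrow> y \<in> T \<Longrightarrow> x \<le> y"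
  shows "sum e D \<le> sum e T"
proof -
  have fin: "finite D" "finite T"
    using assms finite_subset by auto
  have "card (D - T) = card (T - D)"
    using fin assms(5) by (simp add: card_Diff_subset_Int Int_commute)
  then obtain h where h: "bij_betw h (D - T) (T - D)"
    using fin finite_same_card_bij[of "D - T" "T - D"] by auto
  have "sum e (D - T) \<le> (\<Sum>x\<in>D - T. e (h x))"
  proof (rule sum_mono)
    fix x assume x: "x \<in> D - T"
    then have "h x \<in> T - D"
      using h bij_betwE by blast
    then show "e x \<le> e (h x)"
      using x assms(3,4) upper[of x "h x"] by (intro mono_onD[OF assms(2)]) auto
  qed
  also have "\<dots> = sum e (T - D)"
    using h by (rule sum.reindex_bij_betw)
  finally have "sum e (D - T) \<le> sum e (T - D)" .
  moreover have "sum e D = sum e (D \<inter> T) + sum e (D - T)"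
    using fin by (simp add: sum.Int_Diff)
  moreover have "sum e T = sum e (D \<inter> T) + sum e (T - D)"
    using fin by (metis sum.Int_Diff Int_commute)
  ultimately show ?thesis
    by simp
qed

lemma measure_elementary_box:
  assumes "b > 0"
  shows "measure (lebesgue_measure s) (elementary_box b s d a) = 1 / real b ^ (\<Sum>i=1..s. d i)"
proof -
  interpret product_sigma_finite "\<lambda>_::nat. lborel :: real measure" ..
  have "emeasure (lebesgue_measure s) (elementary_box b s d a) =
      (\<Prod>i=1..s. emeasure lborel {real (a i) / real b ^ d i ..< (real (a i) + 1) / real b ^ d i})"
    unfolding lebesgue_measure_def elementary_box_def by (rule emeasure_PiM) auto
  also have "\<dots> = (\<Prod>i=1..s. ennreal (1 / real b ^ d i))"
    by (intro prod.cong refl, subst emeasure_lborel_Ico)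
      (use assms in \<open>auto simp: divide_right_mono diff_divide_distrib[symmetric]\<close>)
  also have "\<dots> = ennreal (\<Prod>i=1..s. 1 / real b ^ d i)"
    by (intro prod_ennreal) simp
  also have "(\<Prod>i=1..s. 1 / real b ^ d i) = 1 / real b ^ (\<Sum>i=1..s. d i)"
    by (simp add: prod_dividef power_sum)
  finally show ?thesis
    by (simp add: measure_def)
qed

definition cell_index :: "nat \<Rightarrow> real \<Rightarrow> nat" where
  "cell_index l y = nat \<lfloor>y * real l\<rfloor>"

lemma cell_index_eq_iff:
  assumes "l > 0" "0 \<le> y"
  shows "cell_index l y = x \<longleftrightarrow> y \<in> {real x / real l ..< (real x + 1) / real l}"
proof -
  have "cell_index l y = x \<longleftrightarrow> \<lfloor>y * real l\<rfloor> = int x"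
    using assms by (auto simp: cell_index_def)
  also have "\<dots> \<longleftrightarrow> real x \<le> y * real l \<and> y * real l < real x + 1"
    by (simp add: floor_eq_iff)
  also have "\<dots> \<longleftrightarrow> y \<in> {real x / real l ..< (real x + 1) / real l}"
    using assms by (simp add: field_simps)
  finally show ?thesis .
qed

lemma cell_index_less:
  assumes "0 \<le> y" "y < 1" "l > 0"
  shows "cell_index l y < l"
proof -
  have "y * real l < real l"
    using assms by simp
  then show ?thesis
    using assms by (simp add: cell_index_def nat_less_iff floor_less_iff)
qed

lemma column_levels_singletons: "column_levels (map (\<lambda>i. (f i, 1)) xs) = map f xs"
  by (induction xs) (auto simp: column_levels_def)

text \<open>
  Directions outside \<open>D\<close> get resolution \<open>0\<close>, where the single cell is all of \<open>[0,1)\<close> and so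
  imposes no condition.
\<close>

lemma card_net_points_with_cell_indices:
  assumes net: "is_net b 0 m e s P" and D: "D \<subseteq> {1..s}" and le: "sum e D \<le> m"
    and x: "\<And>i. i \<in> D \<Longrightarrow> x i < b ^ e i"
  shows "card {r. r < b ^ m \<and> (\<forall>i\<in>D. cell_index (b ^ e i) (P r i) = x i)} = b ^ (m - sum e D)"
proof -
  define d where "d i = (if i \<in> D then e i else 0)" for i
  define a where "a i = (if i \<in> D then x i else 0)" for i
  have b: "b \<ge> 2" and cube: "\<And>r. r < b ^ m \<Longrightarrow> P r \<in> unit_cube s"
    using net by (auto simp: is_net_def)
  from net have net_count: "\<forall>d a. (\<forall>i\<in>{1..s}. a i < b ^ d i \<and> e i dvd d i) \<longrightarrow>
      measure (lebesgue_measure s) (elementary_box b s d a) \<ge> real b powi (int 0 - int m) \<longrightarrow>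
      real (card {n. n < b ^ m \<and> P n \<in> elementary_box b s d a}) =
        real b ^ m * measure (lebesgue_measure s) (elementary_box b s d a)"
    unfolding is_net_def by (elim conjE)
  have "(\<Sum>i=1..s. d i) = sum e D"
    using D by (simp add: d_def sum.If_cases Int_absorb1)
  then have vol: "measure (lebesgue_measure s) (elementary_box b s d a) = 1 / real b ^ sum e D"
    using measure_elementary_box[of b s d a] b by simp
  have "real b powi (int 0 - int m) = 1 / real b ^ m"
    by (simp add: power_int_minus divide_inverse)
  also have "\<dots> \<le> 1 / real b ^ sum e D"
    using b le by (intro divide_left_mono power_increasing) auto
  finally have large: "measure (lebesgue_measure s) (elementary_box b s d a)
      \<ge> real b powi (int 0 - int m)"
    by (simp only: vol)
  have adm: "\<forall>i\<in>{1..s}. a i < b ^ d i \<and> e i dvd d i"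
    using x by (auto simp: a_def d_def)
  have "real (card {r. r < b ^ m \<and> P r \<in> elementary_box b s d a}) =
      real b ^ m * measure (lebesgue_measure s) (elementary_box b s d a)"
    using net_count adm large by blast
  also have "\<dots> = real b ^ m / real b ^ sum e D"
    by (simp add: vol)
  also have "\<dots> = real b ^ (m - sum e D)"
    using b le by (intro power_diff[symmetric]) auto
  also have "\<dots> = real (b ^ (m - sum e D))"
    by (rule of_nat_power[symmetric])
  finally have count: "card {r. r < b ^ m \<and> P r \<in> elementary_box b s d a} = b ^ (m - sum e D)"
    by (simp only: of_nat_eq_iff)
  have "P r \<in> elementary_box b s d a \<longleftrightarrow> (\<forall>i\<in>D. cell_index (b ^ e i) (P r i) = x i)"
    if r: "r < b ^ m" for r
  proof -
    have P: "P r \<in> extensional {1..s}" "\<And>i. i \<in> {1..s} \<Longrightarrow> 0 \<le> P r i \<and> P r i < 1"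
      using cube[OF r] by (auto simp: unit_cube_def PiE_iff)
    have "P r i \<in> {real (a i) / real b ^ d i ..< (real (a i) + 1) / real b ^ d i} \<longleftrightarrow>
        (i \<in> D \<longrightarrow> cell_index (b ^ e i) (P r i) = x i)" if "i \<in> {1..s}" for i
    proof (cases "i \<in> D")
      case True
      then show ?thesis
        using cell_index_eq_iff[of "b ^ e i" "P r i" "x i"] P(2)[OF that] b
        by (simp add: a_def d_def)
    next
      case False
      then show ?thesis
        using P(2)[OF that] by (simp add: a_def d_def)
    qed
    then show ?thesis
      using P(1) D unfolding elementary_box_def PiE_iff by blast
  qed
  then have "{r. r < b ^ m \<and> (\<forall>i\<in>D. cell_index (b ^ e i) (P r i) = x i)} =
      {r. r < b ^ m \<and> P r \<in> elementary_box b s d a}"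
    by blast
  then show ?thesis
    using count by simp
qed

theorem theorem1:
  fixes b s t m :: nat and e :: "nat \<Rightarrow> nat"
  assumes "b \<ge> 2" and "s \<ge> 1"
    and "\<forall>i\<in>{1..s}. e i \<ge> 1"
    and "mono_on {1..s} e"
    and "2 \<le> t" and "t \<le> s"
    and "m \<ge> (\<Sum>i = s - t + 1..s. e i)"
    and "\<exists>P. is_net b 0 m e s P"
  shows "\<exists>A. is_mixed_OA (b ^ m) (map (\<lambda>i. (b ^ e i, 1)) [1..<s + 1]) t A"
proof -
  obtain P where net: "is_net b 0 m e s P"
    using assms(8) by blast
  define ls where "ls = map (\<lambda>i. b ^ e i) [1..<s + 1]"
  \<comment> \<open>Columns are counted from \<open>0\<close>, coordinates from \<open>1\<close>.\<close>
  define A where "A r j = cell_index (b ^ e (Suc j)) (P r (Suc j))" for r j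
  have ls_nth: "ls ! j = b ^ e (Suc j)" if "j < s" for j
    using that by (simp add: ls_def del: upt_Suc)
  have levels: "b ^ e i \<ge> 2" if "i \<in> {1..s}" for i
  proof -
    have "b ^ 1 \<le> b ^ e i"
      using assms(1,3) that by (intro power_increasing) auto
    then show ?thesis
      using assms(1) by simp
  qed
  have entries: "A r j \<in> R (ls ! j)" if "r < b ^ m" "j < s" for r j
  proof -
    have "P r \<in> unit_cube s"
      using net that by (auto simp: is_net_def)
    then have "0 \<le> P r (Suc j)" "P r (Suc j) < 1"
      using that by (auto simp: unit_cube_def PiE_iff)
    then show ?thesis
      using cell_index_less assms(1) that by (simp add: R_def ls_nth A_def)
  qed
  have balanced: "\<exists>c. \<forall>x\<in>(\<Pi>\<^sub>E j\<in>C. R (ls ! j)).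
      card {r. r < b ^ m \<and> (\<forall>j\<in>C. A r j = x j)} = c"
    if C: "C \<subseteq> {..<s}" "card C = t" for C
  proof -
    have D: "Suc ` C \<subseteq> {1..s}"
      using C by auto
    have "sum e (Suc ` C) \<le> sum e {s - t + 1..s}"
      by (rule sum_le_sum_upper_set[where A = "{1..s}"])
        (use D C assms(4,6) in \<open>auto simp: card_image\<close>)
    then have le: "sum e (Suc ` C) \<le> m"
      using assms(7) by simp
    have "card {r. r < b ^ m \<and> (\<forall>j\<in>C. A r j = x j)} = b ^ (m - sum e (Suc ` C))"
      if x: "x \<in> (\<Pi>\<^sub>E j\<in>C. R (ls ! j))" for x
    proof -
      have "x (i - 1) < b ^ e i" if i: "i \<in> Suc ` C" for i
      proof -
        obtain j where j: "i = Suc j" "j \<in> C"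
          using i by blast
        then have "x j \<in> R (ls ! j)" "j < s"
          using x C by auto
        then show ?thesis
          using j by (simp add: R_def ls_nth)
      qed
      from card_net_points_with_cell_indices[OF net D le, of "\<lambda>i. x (i - 1)", OF this]
      show ?thesis
        by (simp add: A_def)
    qed
    then show ?thesis
      by blast
  qed
  have ne: "map (\<lambda>i. (b ^ e i, 1::nat)) [1..<s + 1] \<noteq> []"
    using assms(2) by simp
  have sizes: "\<forall>(l, k)\<in>set (map (\<lambda>i. (b ^ e i, 1::nat)) [1..<s + 1]). 2 \<le> l \<and> 1 \<le> k"
    using levels by auto
  have "length ls = s"
    by (simp add: ls_def del: upt_Suc)
  moreover have "b ^ m \<ge> 1"
    using assms(1) by simp
  ultimately have "is_mixed_OA (b ^ m) (map (\<lambda>i. (b ^ e i, 1)) [1..<s + 1]) t A"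
    unfolding is_mixed_OA_def Let_def column_levels_singletons ls_def[symmetric]
    using ne sizes assms(6) entries balanced by blast
  then show ?thesis
    by blast
qed

end
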